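(* Let $P\in\mathbb{Z}[x]$ be a monic polynomial of degree $d$ with constant coefficient $a_0=\pm1$ and roots $\alpha_1,\dots,\alpha_d$, let $K$ be its splitting field, let $R$ be the ring of integers of $K$, and let $m\in\mathbb{Z}_{>1}$. For each $j$ let $m_j$ be the order of (the class of) $\alpha_j$ in the group $(R/mR)^\times$, and let $M=\operatorname{lcm}(m_1,\dots,m_d)$. If $n$ is a positive integer divisible by $M$, then $\Delta(P_n)$ is divisible by $m^{d(d-1)}$.
   Context: Since $a_0=\pm1$, each $\alpha_j$ is a unit of $R$, so its class lies in $(R/mR)^\times$. For $n\ge1$, $P_n(x):=\prod_{j=1}^d(x-\alpha_j^n)\in\mathbb{Z}[x]$ and $\Delta(P_n)=\prod_{1\le j<k\le d}(\alpha_j^n-\alpha_k^n)^2$ is its discriminant. *)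

theory Defs
  imports
    "HOL-Algebra.Generated_Fields"
    "HOL-Algebra.Multiplicative_Group"
    "HOL-Algebra.QuotRing"
    "HOL-Algebra.Algebraic_Closure_Type"
    "HOL-Computational_Algebra.Computational_Algebra"
begin

text \<open>
  Everything takes place inside a fixed field \<open>'a\<close> of characteristic 0. If an integer polynomial
  splits into linear factors over \<open>'a\<close>, the subfield generated by its roots is a splitting field
  over the rationals (the prime field need not be adjoined separately).
\<close>

definition splitting_field :: "int poly \<Rightarrow> 'a::field_char_0 set" where
  "splitting_field P =
     generate_field ring_of_type_algebra {x. poly (map_poly of_int P) x = 0}"

definition ring_of_integers :: "'a::field_char_0 set \<Rightarrow> 'a ring" where
  "ring_of_integers K =
     ring_of_type_algebra\<lparr>carrier := {x \<in> K. algebraic_int x}\<rparr>"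

text \<open>
  The order of the class of \<open>x\<close> in the unit group of \<open>R/aR\<close>. It is meaningful only if
  that class is a unit.
\<close>

definition residue_order :: "'a ring \<Rightarrow> 'a \<Rightarrow> 'a \<Rightarrow> nat" where
  "residue_order R a x =
     group.ord (units_of (R Quot (PIdl\<^bsub>R\<^esub> a))) ((PIdl\<^bsub>R\<^esub> a) +>\<^bsub>R\<^esub> x)"

text \<open>
  The discriminant of the monic polynomial of degree \<open>d\<close> with the roots
  \<open>\<beta> 1, \<dots>, \<beta> d\<close>, listed with multiplicity.
\<close>

definition discriminant_of_roots :: "nat \<Rightarrow> (nat \<Rightarrow> 'a::field_char_0) \<Rightarrow> 'a" where
  "discriminant_of_roots d \<beta> =
     (\<Prod>(j, k)\<in>{(j, k). 1 \<le> j \<and> j < k \<and> k \<le> d}. (\<beta> j - \<beta> k)\<^sup>2)"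

end

theory Submission
  imports Defs "Jordan_Normal_Form.Char_Poly"
begin

text \<open>
  If \<open>M\<close> divides \<open>n\<close>, then \<open>\<alpha>\<^sub>j\<^sup>n = 1 + m b\<^sub>j\<close> with algebraic integers \<open>b\<^sub>j\<close>. Hence
  \<open>\<Delta>(P\<^sub>n)\<close> is \<open>m\<close> to the power \<open>d(d - 1)\<close> times the algebraic integer \<open>E = \<Prod>\<^sub>j\<^sub><\<^sub>k (b\<^sub>j - b\<^sub>k)\<^sup>2\<close>.
  Since \<open>\<Delta>(P\<^sub>n)\<close> is rational, so is \<open>E\<close>, and a rational algebraic integer is an integer.

  Rationality of the discriminant uses Newton's identities twice instead of symmetric polynomials
  or Galois theory: the power sums of the \<open>\<alpha>\<^sub>j\<close> are rational; by binomial expansion so are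
  the power sums of the numbers \<open>(\<alpha>\<^sub>j\<^sup>n - \<alpha>\<^sub>k\<^sup>n)\<^sup>2\<close>; hence so is the product of these numbers.
\<close>

unbundle no fps_syntax

section \<open>Algebraic integers form a ring\<close>

interpretation int_module: Modules.module "\<lambda>(c::int) (x::'a::comm_ring_1). of_int c * x"
  by unfold_locales (auto simp: algebra_simps)

text \<open>
  Multiplication by \<open>z\<close> acts on the elements of \<open>B\<close> by an integer matrix, so \<open>z\<close> is a root of its
  characteristic polynomial.
\<close>

lemma algebraic_int_if_mult_stable:
  fixes z :: "'a::field_char_0"
  assumes "finite B" and "b \<in> B" "b \<noteq> 0"
    and stable: "\<And>b. b \<in> B \<Longrightarrow> z * b \<in> int_module.span B"
  shows "algebraic_int z"
proof -
  define n where "n = card B"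
  obtain f where f: "bij_betw f {0..<n} B"
    using ex_bij_betw_nat_finite[OF \<open>finite B\<close>] unfolding n_def by blast
  have "\<exists>c. \<forall>b\<in>B. z * b = (\<Sum>b'\<in>B. of_int (c b b') * b')"
  proof (rule exI, rule ballI)
    fix b assume "b \<in> B"
    then have "\<exists>u. z * b = (\<Sum>b'\<in>B. of_int (u b') * b')"
      using stable[of b] int_module.span_finite[OF \<open>finite B\<close>] by auto
    \<comment> \<open>Unification fixes the witness for \<open>c\<close> here: \<open>c b\<close> is
      the coefficient function that \<open>SOME\<close> picks for \<open>b\<close>.\<close>
    then show "z * b = (\<Sum>b'\<in>B. of_int ((SOME u. z * b = (\<Sum>b'\<in>B. of_int (u b') * b')) b') * b')"
      by (rule someI_ex)
  qed
  then obtain c where c: "\<And>b. b \<in> B \<Longrightarrow> z * b = (\<Sum>b'\<in>B. of_int (c b b') * b')"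
    by blast
  define A :: "int mat" where "A = mat n n (\<lambda>(i, j). c (f i) (f j))"
  define A' :: "'a mat" where "A' = map_mat of_int A"
  define v where "v = vec n f"
  have A: "A \<in> carrier_mat n n" and A': "A' \<in> carrier_mat n n"
    by (auto simp: A_def A'_def)
  \<comment> \<open>\<open>v\<close> lists the elements of \<open>B\<close>, so the chosen
    expansions of \<open>z * b\<close> make it an eigenvector for \<open>z\<close>; the nonzero
    element \<open>b\<close> keeps it from vanishing.\<close>
  have "A' *\<^sub>v v = z \<cdot>\<^sub>v v"
  proof (rule eq_vecI)
    fix i assume "i < dim_vec (z \<cdot>\<^sub>v v)"
    then have i: "i < n" by (simp add: v_def)
    have "(A' *\<^sub>v v) $ i = (\<Sum>j\<in>{0..<n}. of_int (c (f i) (f j)) * f j)"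
      using i by (simp add: A'_def A_def v_def scalar_prod_def)
    also have "\<dots> = (\<Sum>b'\<in>B. of_int (c (f i) b') * b')"
      by (rule sum.reindex_bij_betw[OF f])
    also have "\<dots> = z * f i"
      using c f i by (metis atLeastLessThan_iff bij_betwE zero_le)
    finally show "(A' *\<^sub>v v) $ i = (z \<cdot>\<^sub>v v) $ i"
      using i by (simp add: v_def)
  qed (auto simp: A'_def A_def v_def)
  moreover have "v \<noteq> 0\<^sub>v n"
  proof
    assume v0: "v = 0\<^sub>v n"
    obtain i where i: "i < n" "f i = b"
      using f \<open>b \<in> B\<close> by (auto simp: bij_betw_def)
    have "v $ i = 0" using i v0 by simp
    then show False using i \<open>b \<noteq> 0\<close> by (simp add: v_def)
  qed
  ultimately have "eigenvalue A' z"
    unfolding eigenvalue_def eigenvector_def using A' by (intro exI[of _ v]) (auto simp: v_def)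
  then have "poly (map_poly of_int (char_poly A)) z = 0"
    unfolding eigenvalue_root_char_poly[OF A'] unfolding A'_def of_int_hom.char_poly_hom[OF A] .
  moreover have "lead_coeff (char_poly A) = 1"
    using degree_monic_char_poly[OF A] by simp
  ultimately show ?thesis
    unfolding algebraic_int_altdef_ipoly by blast
qed

text \<open>By linearity, stability passes from generators to their span. Products need this:
  \<open>y * b\<close> is only a combination of elements of \<open>B\<close> when \<open>x\<close>
  is applied to it.\<close>

lemma mult_span_stable:
  fixes z :: "'a::comm_ring_1"
  assumes "\<And>b. b \<in> B \<Longrightarrow> z * b \<in> int_module.span B" and "s \<in> int_module.span B"
  shows "z * s \<in> int_module.span B"
  using assms(2)
proof (induction rule: int_module.span_induct_alt)
  case base
  then show ?case by (simp add: int_module.span_zero)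
next
  case (step c x y)
  have "z * (of_int c * x + y) = of_int c * (z * x) + z * y"
    by (simp add: algebra_simps)
  then show ?case
    using int_module.span_add[OF int_module.span_scale[OF assms(1)[OF step(1)]] step(2)] by simp
qed

text \<open>A monic equation expresses the top power of \<open>x\<close> by lower ones. The factor
  \<open>y\<close> is carried along so that the relation applies to monomials in two
  elements.\<close>

lemma algebraic_int_power_in_span:
  fixes x :: "'a::field_char_0"
  assumes "algebraic_int x"
  obtains k where "k > 0" "\<And>y. x ^ k * y \<in> int_module.span ((\<lambda>i. x ^ i * y) ` {..<k})"
proof -
  obtain p where p: "poly (map_poly of_int p) x = 0" "lead_coeff p = 1"
    using assms unfolding algebraic_int_altdef_ipoly by blast
  \<comment> \<open>A constant monic polynomial is 1 and has no root.\<close>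
  have "degree p > 0"
    using p by (intro Nat.gr0I) (auto elim!: degree_eq_zeroE)
  moreover have "x ^ degree p * y \<in> int_module.span ((\<lambda>i. x ^ i * y) ` {..<degree p})" for y
  proof -
    have "(\<Sum>i\<le>degree p. of_int (coeff p i) * x ^ i) = 0"
      using p(1) by (simp add: poly_altdef)
    then have "x ^ degree p = - (\<Sum>i<degree p. of_int (coeff p i) * x ^ i)"
      using p(2) by (simp add: lessThan_Suc_atMost [symmetric] add_eq_0_iff)
    then have "x ^ degree p * y = - (\<Sum>i<degree p. of_int (coeff p i) * (x ^ i * y))"
      by (simp add: sum_distrib_right mult.assoc)
    also have "\<dots> \<in> int_module.span ((\<lambda>i. x ^ i * y) ` {..<degree p})"
      by (intro int_module.span_neg int_module.span_sum int_module.span_scale int_module.span_base) auto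
    finally show ?thesis .
  qed
  ultimately show ?thesis by (rule that)
qed

text \<open>The monomials \<open>x ^ i * y ^ j\<close> below both degrees work: multiplying by
  \<open>x\<close> or \<open>y\<close> raises one exponent by one, and an exponent that reaches its
  bound is reduced by the monic equation. The element 1 later serves as the nonzero member of
  \<open>B\<close>.\<close>

lemma algebraic_int_common_stable:
  fixes x y :: "'a::field_char_0"
  assumes "algebraic_int x" "algebraic_int y"
  obtains B where "finite B" "1 \<in> B"
    "\<And>b. b \<in> B \<Longrightarrow> x * b \<in> int_module.span B" "\<And>b. b \<in> B \<Longrightarrow> y * b \<in> int_module.span B"
proof -
  obtain k where k: "k > 0" "\<And>z. x ^ k * z \<in> int_module.span ((\<lambda>i. x ^ i * z) ` {..<k})"
    using algebraic_int_power_in_span[OF assms(1)] by blast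
  obtain l where l: "l > 0" "\<And>z. y ^ l * z \<in> int_module.span ((\<lambda>i. y ^ i * z) ` {..<l})"
    using algebraic_int_power_in_span[OF assms(2)] by blast
  define B where "B = (\<lambda>(i, j). x ^ i * y ^ j) ` ({..<k} \<times> {..<l})"
  have in_B: "x ^ i * y ^ j \<in> B" if "i < k" "j < l" for i j
    using that by (force simp: B_def)
  show ?thesis
  proof
    show "finite B" by (simp add: B_def)
    show "1 \<in> B" using in_B[of 0 0] k(1) l(1) by simp
  next
    fix b assume "b \<in> B"
    then obtain i j where ij: "b = x ^ i * y ^ j" "i < k" "j < l"
      by (auto simp: B_def)
    have "x ^ Suc i * y ^ j \<in> int_module.span B"
    proof (cases "Suc i < k")
      case True
      then show ?thesis using in_B ij by (intro int_module.span_base) blast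
    next
      case False
      then have "Suc i = k" using ij by simp
      moreover have "(\<lambda>i. x ^ i * y ^ j) ` {..<k} \<subseteq> B"
        using in_B ij by auto
      ultimately show ?thesis
        using k(2)[of "y ^ j"] int_module.span_mono by blast
    qed
    then show "x * b \<in> int_module.span B" by (simp add: ij mult.assoc)
    have "y ^ Suc j * x ^ i \<in> int_module.span B"
    proof (cases "Suc j < l")
      case True
      then show ?thesis using in_B[of i "Suc j"] ij by (intro int_module.span_base) (simp only: mult.commute)
    next
      case False
      then have "Suc j = l" using ij by simp
      moreover have "(\<lambda>j. y ^ j * x ^ i) ` {..<l} \<subseteq> B"
        using in_B ij by (auto simp: mult.commute)
      ultimately show ?thesis
        using l(2)[of "x ^ i"] int_module.span_mono by blast
    qed
    then show "y * b \<in> int_module.span B" by (simp add: ij mult_ac)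
  qed
qed

text \<open>A single \<open>B\<close> is stable under both numbers, hence under their sum and
  product.\<close>

lemma algebraic_int_add_mult:
  fixes x y :: "'a::field_char_0"
  assumes "algebraic_int x" "algebraic_int y"
  shows algebraic_int_add: "algebraic_int (x + y)" and algebraic_int_mult: "algebraic_int (x * y)"
proof -
  obtain B where B: "finite B" "1 \<in> B"
    "\<And>b. b \<in> B \<Longrightarrow> x * b \<in> int_module.span B" "\<And>b. b \<in> B \<Longrightarrow> y * b \<in> int_module.span B"
    using algebraic_int_common_stable[OF assms] by blast
  show "algebraic_int (x + y)"
    by (rule algebraic_int_if_mult_stable[OF B(1,2)])
      (simp_all add: distrib_right int_module.span_add B(3,4))
  show "algebraic_int (x * y)"
    by (rule algebraic_int_if_mult_stable[OF B(1,2)])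
      (simp_all add: mult.assoc mult_span_stable B(3,4))
qed

lemma algebraic_int_diff:
  fixes x y :: "'a::field_char_0"
  assumes "algebraic_int x" "algebraic_int y"
  shows "algebraic_int (x - y)"
  using algebraic_int_add[of x "- y"] assms by simp

lemma algebraic_int_prod:
  fixes f :: "'b \<Rightarrow> 'a::field_char_0"
  assumes "\<And>x. x \<in> A \<Longrightarrow> algebraic_int (f x)"
  shows "algebraic_int (\<Prod>x\<in>A. f x)"
  using assms by (induction A rule: infinite_finite_induct) (auto intro: algebraic_int_mult)

section \<open>Newton's identities and rationality\<close>

lemma fps_nth_0_prod: "fps_nth (\<Prod>a\<in>A. f a) 0 = (\<Prod>a\<in>A. fps_nth (f a) 0)"
  by (induction A rule: infinite_finite_induct) simp_all

text \<open>
  The logarithmic derivative of \<open>\<Prod>(1 - \<gamma>\<^sub>a X)\<close>, with denominators cleared.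
\<close>

lemma newton_identity_fps:
  fixes \<gamma> :: "'b \<Rightarrow> 'a::field_char_0"
  assumes "finite A"
  shows "fps_X * fps_deriv (\<Prod>a\<in>A. 1 - fps_const (\<gamma> a) * fps_X) =
    - ((\<Prod>a\<in>A. 1 - fps_const (\<gamma> a) * fps_X) *
        Abs_fps (\<lambda>k. if k = 0 then 0 else \<Sum>a\<in>A. \<gamma> a ^ k))"
  using assms
proof (induction A rule: finite_induct)
  case empty
  then show ?case by (simp add: fps_eq_iff)
next
  case (insert x A)
  define Q where "Q = (\<Prod>a\<in>A. 1 - fps_const (\<gamma> a) * fps_X)"
  define T where "T = Abs_fps (\<lambda>k. if k = 0 then 0 else \<Sum>a\<in>A. \<gamma> a ^ k)"
  define L where "L = 1 - fps_const (\<gamma> x) * fps_X"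
  define S where "S = Abs_fps (\<lambda>k. if k = 0 then 0 else \<gamma> x ^ k)"
  have split: "Abs_fps (\<lambda>k. if k = 0 then 0 else \<Sum>a\<in>insert x A. \<gamma> a ^ k) = S + T"
    using insert by (auto simp: fps_eq_iff S_def T_def)
  \<comment> \<open>\<open>S\<close> is a geometric series without its constant term, so multiplying
    by \<open>L\<close> leaves only its first term.\<close>
  have LS: "L * S = fps_const (\<gamma> x) * fps_X"
  proof (rule fps_ext)
    fix k
    have "L * S = S - fps_const (\<gamma> x) * (fps_X * S)"
      by (simp add: L_def left_diff_distrib mult.assoc)
    then show "fps_nth (L * S) k = fps_nth (fps_const (\<gamma> x) * fps_X) k"
      by (cases k) (auto simp: S_def)
  qed
  have dL: "fps_deriv L = - fps_const (\<gamma> x)"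
    by (simp add: L_def fps_deriv_mult)
  have IH: "fps_X * fps_deriv Q = - (Q * T)"
    unfolding Q_def T_def by (rule insert.IH)
  \<comment> \<open>By \<open>dL\<close> and \<open>LS\<close> the new factor satisfies the identity
    by itself, \<open>fps_X * fps_deriv L = - (L * S)\<close>; the product rule adds it to
    \<open>IH\<close>.\<close>
  have "fps_X * fps_deriv (L * Q) = L * (fps_X * fps_deriv Q) + (fps_X * fps_deriv L) * Q"
    by (simp add: algebra_simps)
  also have "\<dots> = L * (- (Q * T)) + (fps_X * - fps_const (\<gamma> x)) * Q"
    by (simp only: IH dL)
  also have "\<dots> = - (L * (Q * T)) - (L * S) * Q"
    unfolding LS by (simp add: algebra_simps del: fps_const_neg)
  also have "\<dots> = - ((L * Q) * (S + T))"
    by (simp add: algebra_simps)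
  finally show ?case
    using insert by (simp add: split L_def Q_def)
qed

text \<open>Coefficient comparison in \<open>newton_identity_fps\<close>; the term
  \<open>i = k\<close> drops out because the series of power sums has constant term 0. The identity
  is used in both directions: solved for the power sum in the term \<open>i = 0\<close>, and solved
  for \<open>fps_nth Q k\<close>.\<close>

lemma newton_identity:
  fixes \<gamma> :: "'b \<Rightarrow> 'a::field_char_0"
  assumes "finite A" "k > 0"
  defines "Q \<equiv> \<Prod>a\<in>A. 1 - fps_const (\<gamma> a) * fps_X"
  shows "of_nat k * fps_nth Q k = - (\<Sum>i<k. fps_nth Q i * (\<Sum>a\<in>A. \<gamma> a ^ (k - i)))"
proof -
  have "of_nat k * fps_nth Q k = fps_nth (fps_X * fps_deriv Q) k"
    using \<open>k > 0\<close> by (cases k) auto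
  also have "\<dots> = - (\<Sum>i=0..k. fps_nth Q i * (if k - i = 0 then 0 else \<Sum>a\<in>A. \<gamma> a ^ (k - i)))"
    unfolding Q_def newton_identity_fps[OF \<open>finite A\<close>] by (simp add: fps_mult_nth)
  also have "(\<Sum>i=0..k. fps_nth Q i * (if k - i = 0 then 0 else \<Sum>a\<in>A. \<gamma> a ^ (k - i))) =
      (\<Sum>i<k. fps_nth Q i * (\<Sum>a\<in>A. \<gamma> a ^ (k - i)))"
    by (rule sum.mono_neutral_cong_right) auto
  finally show ?thesis .
qed

text \<open>Reversal is multiplicative and turns \<open>X - \<gamma>\<close> into
  \<open>1 - \<gamma> X\<close>, also for a zero root, since the reversal of \<open>X\<close> is 1.
  This links Newton's identity to the coefficients of a polynomial with given roots.\<close>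

lemma reflected_linear_product:
  fixes \<gamma> :: "'b \<Rightarrow> 'a::field_char_0"
  shows "fps_of_poly (reflect_poly (\<Prod>a\<in>A. [:- \<gamma> a, 1:])) = (\<Prod>a\<in>A. 1 - fps_const (\<gamma> a) * fps_X)"
proof -
  have linear: "fps_of_poly (reflect_poly [:- c, 1:]) = 1 - fps_const c * fps_X" for c :: 'a
    by (simp add: reflect_poly_pCons' monom_Suc monom_0 fps_of_poly_pCons flip: fps_const_neg)
  show ?thesis
    unfolding reflect_poly_prod fps_of_poly_prod linear ..
qed

text \<open>Newton's identity is solved for the \<open>k\<close>-th power sum: its coefficient is
  \<open>fps_nth Q 0 = 1\<close>, and only lower power sums remain. For \<open>k = 0\<close> the sum
  is \<open>card A\<close>.\<close>

lemma power_sums_rational: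
  fixes \<gamma> :: "'b \<Rightarrow> 'a::field_char_0"
  assumes "finite A" and "\<And>i. coeff (\<Prod>a\<in>A. [:- \<gamma> a, 1:]) i \<in> \<rat>"
  shows "(\<Sum>a\<in>A. \<gamma> a ^ k) \<in> \<rat>"
proof (induction k rule: less_induct)
  case (less k)
  define Q where "Q = (\<Prod>a\<in>A. 1 - fps_const (\<gamma> a) * fps_X)"
  have Q: "fps_nth Q i \<in> \<rat>" for i
    using assms(2) unfolding Q_def reflected_linear_product[symmetric] by (simp add: coeff_reflect_poly)
  show ?case
  proof (cases "k = 0")
    case False
    have "fps_nth Q 0 = 1"
      by (simp add: Q_def fps_nth_0_prod)
    moreover have "{..<k} = insert 0 {1..<k}"
      using False by auto
    ultimately have newton: "of_nat k * fps_nth Q k =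
        - (\<Sum>a\<in>A. \<gamma> a ^ k) - (\<Sum>i=1..<k. fps_nth Q i * (\<Sum>a\<in>A. \<gamma> a ^ (k - i)))"
      using newton_identity[OF assms(1), of k \<gamma>, folded Q_def] False by simp
    have "(\<Sum>a\<in>A. \<gamma> a ^ k) =
        - (of_nat k * fps_nth Q k) - (\<Sum>i=1..<k. fps_nth Q i * (\<Sum>a\<in>A. \<gamma> a ^ (k - i)))"
      unfolding newton by simp
    also have "\<dots> \<in> \<rat>"
      using less.IH Q by (intro Rats_diff Rats_sum[of "{1..<k}"] Rats_mult) auto
    finally show ?thesis .
  qed simp
qed

text \<open>Conversely, Newton's identity gives \<open>fps_nth Q k\<close> after division by
  \<open>k\<close>, which is nonzero in characteristic 0. The product is, up to sign, one of these
  coefficients.\<close>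

lemma prod_rational_if_power_sums_rational:
  fixes \<gamma> :: "'b \<Rightarrow> 'a::field_char_0"
  assumes "finite A" and "\<And>k. k > 0 \<Longrightarrow> (\<Sum>a\<in>A. \<gamma> a ^ k) \<in> \<rat>"
  shows "(\<Prod>a\<in>A. \<gamma> a) \<in> \<rat>"
proof -
  define Q where "Q = (\<Prod>a\<in>A. 1 - fps_const (\<gamma> a) * fps_X)"
  define p where "p = (\<Prod>a\<in>A. [:- \<gamma> a, 1:])"
  have Q: "fps_nth Q k \<in> \<rat>" for k
  proof (induction k rule: less_induct)
    case (less k)
    show ?case
    proof (cases "k = 0")
      case True
      then show ?thesis by (simp add: Q_def fps_nth_0_prod)
    next
      case False
      then have "fps_nth Q k = - (\<Sum>i<k. fps_nth Q i * (\<Sum>a\<in>A. \<gamma> a ^ (k - i))) / of_nat k"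
        using newton_identity[OF assms(1), of k \<gamma>, folded Q_def] by (simp add: field_simps)
      also have "\<dots> \<in> \<rat>"
        unfolding minus_divide_left[symmetric] Rats_minus_iff
        using less.IH assms(2) by (intro Rats_divide Rats_sum[of "{..<k}"] Rats_mult) auto
      finally show ?thesis .
    qed
  qed
  \<comment> \<open>Reversal is around \<open>degree p\<close>, so this is the constant term of
    \<open>p\<close> even if a zero root lowers the degree of the reversed polynomial.\<close>
  have "coeff (reflect_poly p) (degree p) = poly p 0"
    by (simp add: coeff_reflect_poly poly_0_coeff_0)
  also have "\<dots> = (\<Prod>a\<in>A. - \<gamma> a)"
    by (simp add: p_def poly_prod)
  also have "\<dots> = (- 1) ^ card A * (\<Prod>a\<in>A. \<gamma> a)"
    by (simp add: prod_uminus)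
  finally have "(- 1) ^ card A * (\<Prod>a\<in>A. \<gamma> a) \<in> \<rat>"
    using Q[of "degree p"] unfolding Q_def reflected_linear_product[symmetric] p_def[symmetric] by simp
  then show ?thesis
    by (cases "even (card A)") auto
qed

section \<open>Sums over pairs and rationality of the discriminant\<close>

text \<open>The square of indices splits into the diagonal, where \<open>g\<close> vanishes, and two
  triangles exchanged by \<open>prod.swap\<close>. Sums over \<open>j < k\<close> thus become double
  sums with independent indices.\<close>

lemma sum_pairs_symmetric:
  fixes g :: "nat \<Rightarrow> nat \<Rightarrow> 'a::comm_ring_1"
  assumes "\<And>j k. g j k = g k j" and "\<And>j. g j j = 0"
  shows "(\<Sum>j=1..d. \<Sum>k=1..d. g j k) = 2 * (\<Sum>(j, k)\<in>{(j, k). 1 \<le> j \<and> j < k \<and> k \<le> d}. g j k)"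
proof -
  let ?U = "{(j, k). 1 \<le> j \<and> j < k \<and> k \<le> d}"
  let ?L = "{(j, k). 1 \<le> k \<and> k < j \<and> j \<le> d}"
  let ?D = "(\<lambda>j. (j, j)) ` {1..d}"
  have fin: "finite ?U" "finite ?L"
    by (rule finite_subset[of _ "{1..d} \<times> {1..d}"]; auto)+
  have U: "{1..d} \<times> {1..d} = ?D \<union> (?U \<union> ?L)" by auto
  have "(\<Sum>j=1..d. \<Sum>k=1..d. g j k) = (\<Sum>(j, k)\<in>?D \<union> (?U \<union> ?L). g j k)"
    unfolding U[symmetric] by (rule sum.cartesian_product)
  also have "\<dots> = (\<Sum>(j, k)\<in>?D. g j k) + (\<Sum>(j, k)\<in>?U \<union> ?L. g j k)"
    using fin by (intro sum.union_disjoint) auto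
  also have "(\<Sum>(j, k)\<in>?D. g j k) = 0"
    using assms(2) by (intro sum.neutral) auto
  also have "(\<Sum>(j, k)\<in>?U \<union> ?L. g j k) = (\<Sum>(j, k)\<in>?U. g j k) + (\<Sum>(j, k)\<in>?L. g j k)"
    using fin by (intro sum.union_disjoint) auto
  also have "(\<Sum>(j, k)\<in>?L. g j k) = (\<Sum>(j, k)\<in>?U. g j k)"
    by (rule sum.reindex_bij_witness[of _ prod.swap prod.swap]) (auto simp: assms(1))
  finally show ?thesis by simp
qed

text \<open>Applies \<open>sum_pairs_symmetric\<close> to the indicator of
  \<open>j \<noteq> k\<close>, in \<open>int\<close> so that subtraction is harmless. The exponent
  of \<open>m\<close> in the theorem comes from here.\<close>

lemma card_pairs: "2 * card {(j, k). 1 \<le> j \<and> j < k \<and> k \<le> (d::nat)} = d * (d - 1)"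
proof -
  have "int (d * d) - int d = (\<Sum>j=1..d. \<Sum>k=1..d. if j = k then 0 else 1)"
  proof -
    have "(\<Sum>k=1..d. if j = k then 0 else 1::int) = int d - 1" if "j \<in> {1..d}" for j
    proof -
      have "(\<Sum>k=1..d. if j = k then 0 else 1::int) = (\<Sum>k=1..d. 1 - (if j = k then 1 else 0))"
        by (rule sum.cong) auto
      also have "\<dots> = int d - 1"
        using that by (simp add: sum_subtractf)
      finally show ?thesis .
    qed
    then have "(\<Sum>j=1..d. \<Sum>k=1..d. if j = k then 0 else 1) = (\<Sum>j=1..d. int d - 1)"
      by (intro sum.cong) auto
    then show ?thesis by (simp add: algebra_simps)
  qed
  also have "\<dots> = 2 * (\<Sum>(j, k)\<in>{(j, k). 1 \<le> j \<and> j < k \<and> k \<le> d}. if j = k then 0 else 1)"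
    by (rule sum_pairs_symmetric) auto
  also have "(\<Sum>(j, k)\<in>{(j, k). 1 \<le> j \<and> j < k \<and> k \<le> d}. if j = k then 0 else 1::int) =
      (\<Sum>_\<in>{(j, k). 1 \<le> j \<and> j < k \<and> k \<le> d}. 1)"
    by (rule sum.cong) auto
  finally have "int (2 * card {(j, k). 1 \<le> j \<and> j < k \<and> k \<le> d}) = int (d * d - d)"
    by (simp add: of_nat_diff)
  then show ?thesis by (simp only: of_nat_eq_iff diff_mult_distrib2 mult_1_right)
qed

lemma discriminant_rational:
  fixes \<beta> :: "nat \<Rightarrow> 'a::field_char_0"
  assumes "\<And>k. (\<Sum>j=1..d. \<beta> j ^ k) \<in> \<rat>"
  shows "discriminant_of_roots d \<beta> \<in> \<rat>"
proof -
  let ?U = "{(j, k). 1 \<le> j \<and> j < k \<and> k \<le> d}"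
  have "finite ?U"
    by (rule finite_subset[of _ "{1..d} \<times> {1..d}"]) auto
  moreover have "(\<Sum>a\<in>?U. (case a of (j, k) \<Rightarrow> (\<beta> j - \<beta> k)\<^sup>2) ^ e) \<in> \<rat>" if "e > 0" for e
  proof -
    have binom: "(x - y) ^ (2 * e) = (\<Sum>i\<le>2 * e. of_nat (2 * e choose i) * (- 1) ^ (2 * e - i) * (x ^ i * y ^ (2 * e - i)))" for x y :: 'a
      using binomial_ring[of x "- y" "2 * e"] by (simp add: power_minus[of y] mult_ac)
    \<comment> \<open>The even exponent makes the summand symmetric, and \<open>e > 0\<close> makes
      it vanish on the diagonal.\<close>
    have "2 * (\<Sum>(j, k)\<in>?U. (\<beta> j - \<beta> k) ^ (2 * e)) = (\<Sum>j=1..d. \<Sum>k=1..d. (\<beta> j - \<beta> k) ^ (2 * e))"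
      using that by (intro sum_pairs_symmetric[symmetric]) (auto simp: power_mult power2_commute)
    also have "\<dots> = (\<Sum>j=1..d. \<Sum>i\<le>2 * e. \<Sum>k=1..d. of_nat (2 * e choose i) * (- 1) ^ (2 * e - i) * (\<beta> j ^ i * \<beta> k ^ (2 * e - i)))"
      unfolding binom by (rule sum.cong[OF refl], rule sum.swap)
    also have "\<dots> = (\<Sum>i\<le>2 * e. \<Sum>j=1..d. \<Sum>k=1..d. of_nat (2 * e choose i) * (- 1) ^ (2 * e - i) * (\<beta> j ^ i * \<beta> k ^ (2 * e - i)))"
      by (rule sum.swap)
    \<comment> \<open>For fixed \<open>i\<close> the indices \<open>j\<close> and \<open>k\<close>
      separate, so the double sum is a product of two power sums.\<close>
    also have "\<dots> = (\<Sum>i\<le>2 * e. of_nat (2 * e choose i) * (- 1) ^ (2 * e - i) * ((\<Sum>j=1..d. \<beta> j ^ i) * (\<Sum>k=1..d. \<beta> k ^ (2 * e - i))))"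
      unfolding sum_product by (simp only: sum_distrib_left)
    also have "\<dots> \<in> \<rat>"
      by (intro Rats_sum[of "{..2 * e}"] Rats_mult Rats_power assms) auto
    finally have "2 * (\<Sum>(j, k)\<in>?U. (\<beta> j - \<beta> k) ^ (2 * e)) / 2 \<in> \<rat>"
      by (rule Rats_divide) simp
    then show ?thesis
      by (simp add: power_mult case_prod_unfold)
  qed
  ultimately show ?thesis
    unfolding discriminant_of_roots_def by (rule prod_rational_if_power_sums_rational)
qed

section \<open>Subfields and rings of integers as algebraic structures\<close>

lemma ring_of_type_algebra_simps:
  "carrier ring_of_type_algebra = (UNIV :: 'a::comm_ring_1 set)"
  "x \<otimes>\<^bsub>ring_of_type_algebra\<^esub> y = (x * y :: 'a)"
  "x \<oplus>\<^bsub>ring_of_type_algebra\<^esub> y = (x + y :: 'a)"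
  "\<one>\<^bsub>ring_of_type_algebra\<^esub> = (1 :: 'a)"
  "\<zero>\<^bsub>ring_of_type_algebra\<^esub> = (0 :: 'a)"
  by (simp_all add: ring_of_type_algebra_def)

lemma a_inv_ring_of_type_algebra: "\<ominus>\<^bsub>ring_of_type_algebra\<^esub> x = (- x :: 'a::comm_ring_1)"
proof -
  interpret cring "ring_of_type_algebra :: 'a ring" by (rule cring_from_type_algebra)
  show ?thesis
    by (rule minus_equality) (simp_all add: ring_of_type_algebra_simps)
qed

lemma m_inv_ring_of_type_algebra:
  assumes "x \<noteq> 0"
  shows "inv\<^bsub>ring_of_type_algebra\<^esub> x = (inverse x :: 'a::Fields.field)"
proof -
  interpret cring "ring_of_type_algebra :: 'a ring" by (rule cring_from_type_algebra)
  show ?thesis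
    using assms by (intro comm_inv_char) (simp_all add: ring_of_type_algebra_simps)
qed

lemma subfield_of_type_algebra:
  assumes "subfield K (ring_of_type_algebra :: 'a::Fields.field ring)"
  shows "0 \<in> K" "1 \<in> K" "x \<in> K \<Longrightarrow> y \<in> K \<Longrightarrow> x + y \<in> K" "x \<in> K \<Longrightarrow> y \<in> K \<Longrightarrow> x * y \<in> K"
    "x \<in> K \<Longrightarrow> - x \<in> K" "x \<in> K \<Longrightarrow> inverse x \<in> K"
proof -
  interpret Ring.field "ring_of_type_algebra :: 'a ring" by (rule field_from_type_algebra)
  note sub = subringE[OF subfieldE(1)[OF assms], unfolded ring_of_type_algebra_simps a_inv_ring_of_type_algebra]
  show "0 \<in> K" "1 \<in> K" "x \<in> K \<Longrightarrow> y \<in> K \<Longrightarrow> x + y \<in> K" "x \<in> K \<Longrightarrow> y \<in> K \<Longrightarrow> x * y \<in> K" "x \<in> K \<Longrightarrow> - x \<in> K"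
    using sub by blast+
  show "inverse x \<in> K" if "x \<in> K"
  \<comment> \<open>\<open>inverse 0 = 0\<close> by convention; only for \<open>x \<noteq> 0\<close>
    is \<open>inverse\<close> identified with the inverse of the structure.\<close>
  proof (cases "x = 0")
    case False
    then show ?thesis
      using subfield_m_inv(1)[OF assms, of x] that
      by (simp add: m_inv_ring_of_type_algebra ring_of_type_algebra_simps)
  qed (use that in simp)
qed

lemma ring_of_integers_simps:
  "carrier (ring_of_integers K) = {x \<in> K. algebraic_int x}"
  "x \<otimes>\<^bsub>ring_of_integers K\<^esub> y = x * y"
  "x \<oplus>\<^bsub>ring_of_integers K\<^esub> y = x + y"
  "\<one>\<^bsub>ring_of_integers K\<^esub> = 1"
  "\<zero>\<^bsub>ring_of_integers K\<^esub> = 0"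
  by (simp_all add: ring_of_integers_def ring_of_type_algebra_def)

lemma cring_ring_of_integers:
  fixes K :: "'a::field_char_0 set"
  assumes "subfield K ring_of_type_algebra"
  shows "cring (ring_of_integers K)"
proof -
  interpret cring "ring_of_type_algebra :: 'a ring" by (rule cring_from_type_algebra)
  note K = subfield_of_type_algebra[OF assms]
  have "subring {x \<in> K. algebraic_int x} ring_of_type_algebra"
    by (rule subringI)
      (auto simp: ring_of_type_algebra_simps a_inv_ring_of_type_algebra K algebraic_int_add algebraic_int_mult)
  then have "subcring {x \<in> K. algebraic_int x} ring_of_type_algebra"
    by (rule subcringI')
  then show ?thesis
    unfolding ring_of_integers_def by (simp add: subcring_iff[symmetric] ring_of_type_algebra_simps)
qed

lemma subfield_splitting_field: "subfield (splitting_field P) (ring_of_type_algebra :: 'a::field_char_0 ring)"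
proof -
  interpret Ring.field "ring_of_type_algebra :: 'a ring" by (rule field_from_type_algebra)
  show ?thesis
    unfolding splitting_field_def
    by (rule generate_field_is_subfield) (simp add: ring_of_type_algebra_simps)
qed

lemma root_in_splitting_field:
  "poly (map_poly of_int P) x = 0 \<Longrightarrow> x \<in> splitting_field P"
  unfolding splitting_field_def by (rule generate_field.incl) simp

section \<open>From residue orders to congruences\<close>

text \<open>Reduction modulo \<open>a\<close> sends units to units, so the order belongs to an
  actual element of the unit group and the \<open>n\<close>-th power of the class is 1. Equality of
  cosets then puts the difference into the principal ideal.\<close>

lemma residue_order_dvd_imp:
  fixes R :: "'a ring" (structure)
  assumes "cring R" and a: "a \<in> carrier R" and x: "x \<in> Units R" and dvd: "residue_order R a x dvd n"
  shows "\<exists>b\<in>carrier R. x [^] n = b \<otimes> a \<oplus> \<one>"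
proof -
  interpret cring R by fact
  define I where "I = PIdl a"
  interpret I: ideal I R unfolding I_def using a by (rule cgenideal_ideal)
  interpret Q: cring "R Quot I" by (rule I.quotient_is_cring) (rule is_cring)
  interpret h: ring_hom_cring R "R Quot I" "(+>) I" by (rule I.rcos_ring_hom_cring) (rule is_cring)
  interpret U: group "units_of (R Quot I)" by (rule Q.units_group)
  have xR: "x \<in> carrier R" using x by (rule Units_closed)
  have unit: "I +> x \<in> Units (R Quot I)"
  proof -
    have "I +> x \<in> carrier (R Quot I)" "I +> inv x \<in> carrier (R Quot I)"
      using x by (auto intro!: h.hom_closed)
    moreover have "(I +> x) \<otimes>\<^bsub>R Quot I\<^esub> (I +> inv x) = \<one>\<^bsub>R Quot I\<^esub>"
      using h.hom_mult[of x "inv x"] h.hom_one x xR by (simp del: h.hom_mult)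
    ultimately show ?thesis
      using Q.m_comm[of "I +> x" "I +> inv x"] unfolding Units_def by auto
  qed
  then have "(I +> x) [^]\<^bsub>R Quot I\<^esub> n = \<one>\<^bsub>R Quot I\<^esub>"
    using dvd U.pow_eq_id[of "I +> x" n]
    by (simp add: residue_order_def I_def[symmetric] units_of_carrier units_of_one Q.units_of_pow)
  then have "I +> (x [^] n) = I +> \<one>"
    using xR h.hom_one by (simp add: h.hom_pow)
  then have "x [^] n \<in> I +> \<one>"
    using I.a_rcos_self[of "x [^] n"] xR by simp
  then have "x [^] n \<ominus> \<one> \<in> I"
    using I.a_rcos_module_minus[OF ring_axioms, of "\<one>" "x [^] n"] xR by simp
  then obtain b where b: "b \<in> carrier R" "x [^] n \<ominus> \<one> = b \<otimes> a"
    unfolding I_def cgenideal_def by auto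
  have "x [^] n = (x [^] n \<ominus> \<one>) \<oplus> \<one>"
    using xR by (simp add: minus_eq a_assoc l_neg)
  then show ?thesis using b by auto
qed

text \<open>The constant coefficient 1 or -1 makes \<open>x\<close> a unit of the ring of integers,
  as \<open>residue_order_dvd_imp\<close> requires.\<close>

lemma root_power_congruent_one:
  fixes P :: "int poly" and x :: "'a::field_char_0"
  assumes "lead_coeff P = 1" and "coeff P 0 = 1 \<or> coeff P 0 = -1"
    and root: "poly (map_poly of_int P) x = 0"
    and dvd: "residue_order (ring_of_integers (splitting_field P)) (of_int m) x dvd n"
  shows "\<exists>b. algebraic_int b \<and> x ^ n = of_int m * b + 1"
proof -
  define K where "K = (splitting_field P :: 'a set)"
  define R where "R = ring_of_integers K"
  have "subfield K ring_of_type_algebra"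
    unfolding K_def by (rule subfield_splitting_field)
  note K = subfield_of_type_algebra[OF this] and R = cring_ring_of_integers[OF this, folded R_def]
  note simps = ring_of_integers_simps[of K, folded R_def]
  have xK: "x \<in> K"
    unfolding K_def using root by (rule root_in_splitting_field)
  have xint: "algebraic_int x"
    unfolding algebraic_int_altdef_ipoly using assms(1) root by blast
  \<comment> \<open>Multiplying by the sign \<open>coeff P 0\<close> makes the constant coefficient
    1 and keeps the root; the reversal of \<open>q\<close> is then monic with root
    \<open>inverse x\<close>.\<close>
  define q where "q = smult (coeff P 0) P"
  have "coeff q 0 = 1" and "poly (map_poly of_int q) x = 0"
    using assms(2) root by (auto simp: q_def of_int_hom.map_poly_hom_smult)
  then have inv: "algebraic_int (inverse x)"
    by (intro algebraic_int_inverse[of "map_poly of_int q"]) auto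
  have "x \<noteq> 0"
    using root assms(2) by (auto simp: poly_0_coeff_0)
  then have "x \<in> Units R"
    unfolding Units_def simps using xK xint inv K(6)[OF xK] by (auto intro: bexI[of _ "inverse x"])
  moreover have "of_int m \<in> carrier R"
  proof -
    have "of_nat k \<in> K" for k by (induction k) (auto simp: K)
    then have "of_int m \<in> K" by (cases m rule: int_cases2) (auto simp: K)
    then show ?thesis by (simp add: simps)
  qed
  ultimately obtain b where b: "b \<in> carrier R" "x [^]\<^bsub>R\<^esub> n = b * of_int m + 1"
    using residue_order_dvd_imp[OF R _ _ dvd[folded K_def, folded R_def]] unfolding simps(2-4) by blast
  have "x [^]\<^bsub>R\<^esub> n = x ^ n"
    by (induction n) (simp_all add: simps mult.commute)
  then have "algebraic_int b \<and> x ^ n = of_int m * b + 1"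
    using b by (simp add: simps mult.commute)
  then show ?thesis by blast
qed

section \<open>Divisibility of the discriminant\<close>

theorem theorem8p6:
  fixes P :: "int poly" and d n :: nat and m :: int
    and \<alpha> :: "nat \<Rightarrow> 'a::field_char_0"
  assumes "lead_coeff P = 1" and "degree P = d"
    and "coeff P 0 = 1 \<or> coeff P 0 = -1"
    and "map_poly of_int P = (\<Prod>j=1..d. [:- \<alpha> j, 1:])"
    and "m > 1"
    and "n > 0"
    and "(LCM j\<in>{1..d}.
            residue_order (ring_of_integers (splitting_field P)) (of_int m) (\<alpha> j)) dvd n"
  shows "\<exists>D::int. discriminant_of_roots d (\<lambda>j. \<alpha> j ^ n) = of_int D \<and> m ^ (d * (d - 1)) dvd D"
proof -
  define U where "U = {(j, k). 1 \<le> j \<and> j < k \<and> k \<le> d}"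
  have "\<exists>b. algebraic_int b \<and> \<alpha> j ^ n = of_int m * b + 1" if j: "j \<in> {1..d}" for j
  proof (rule root_power_congruent_one[of P])
    show "poly (map_poly of_int P) (\<alpha> j) = 0"
      unfolding assms(4) poly_prod using j by (intro prod_zero) auto
    show "residue_order (ring_of_integers (splitting_field P)) (of_int m) (\<alpha> j) dvd n"
      using j by (intro dvd_trans[OF dvd_Lcm assms(7)]) auto
  qed (use assms in auto)
  then obtain b where b: "\<And>j. j \<in> {1..d} \<Longrightarrow> algebraic_int (b j)"
      "\<And>j. j \<in> {1..d} \<Longrightarrow> \<alpha> j ^ n = of_int m * b j + 1"
    by metis
  define \<Delta> where "\<Delta> = discriminant_of_roots d (\<lambda>j. \<alpha> j ^ n)"
  define E where "E = discriminant_of_roots d b"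
  \<comment> \<open>The summand 1 cancels in each difference, leaving one factor
    \<open>(of_int m)\<^sup>2\<close> per pair.\<close>
  have "\<Delta> = (\<Prod>(j, k)\<in>U. (of_int m)\<^sup>2 * (b j - b k)\<^sup>2)"
    unfolding \<Delta>_def discriminant_of_roots_def U_def[symmetric]
    by (rule prod.cong) (auto simp: U_def b(2) power_mult_distrib[symmetric] right_diff_distrib)
  also have "\<dots> = (of_int m)\<^sup>2 ^ card U * E"
    by (simp add: case_prod_unfold prod.distrib E_def discriminant_of_roots_def U_def)
  also have "(of_int m :: 'a)\<^sup>2 ^ card U = of_int (m ^ (d * (d - 1)))"
    using card_pairs[of d] by (simp add: U_def flip: power_mult)
  finally have \<Delta>: "\<Delta> = of_int (m ^ (d * (d - 1))) * E" .
  have "coeff (\<Prod>j=1..d. [:- \<alpha> j, 1:]) i \<in> \<rat>" for i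
    unfolding assms(4)[symmetric] by simp
  \<comment> \<open>These are power sums of the \<alpha> j with exponent \<open>n * k\<close>, so
    the polynomial with roots \<open>\<alpha> j ^ n\<close> need not be formed.\<close>
  then have "(\<Sum>j=1..d. (\<alpha> j ^ n) ^ k) \<in> \<rat>" for k
    unfolding power_mult[symmetric] by (intro power_sums_rational) simp_all
  then have "\<Delta> \<in> \<rat>"
    unfolding \<Delta>_def by (rule discriminant_rational)
  then have "\<Delta> / of_int (m ^ (d * (d - 1))) \<in> \<rat>"
    by (rule Rats_divide) simp
  then have "E \<in> \<rat>"
    using \<open>m > 1\<close> by (simp add: \<Delta>)
  moreover have "algebraic_int E"
    unfolding E_def discriminant_of_roots_def power2_eq_square
    by (rule algebraic_int_prod) (auto intro!: algebraic_int_mult algebraic_int_diff b(1))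
  ultimately have "E \<in> \<int>"
    by (intro rational_algebraic_int_is_int)
  then obtain e where "E = of_int e"
    by (rule Ints_cases)
  then have "\<Delta> = of_int (m ^ (d * (d - 1)) * e)"
    by (simp add: \<Delta>)
  then show ?thesis
    unfolding \<Delta>_def using dvd_triv_left by blast
qed

end
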